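(* Let $X$ be a nonempty set of choice functions for $L$. Then $\sim_X$ is logically closed if and only if every $f\in X$ is regular.
   Context: Let $L$ be the propositional language with atoms $p_0,p_1,\ldots$ and connectives $\neg,\wedge$ (others defined as usual); $L_s$ adds a primitive binary connective $|$. $\sim$ denotes classical logical equivalence of $L$-sentences. A truth assignment $M$ is a classical valuation of $Sen(L)$. A choice function for $L$ is a map $f$ assigning to each set $\{\alpha,\beta\}$ of $L$-sentences (possibly $\alpha=\beta$) an element $f(\alpha,\beta)\in\{\alpha,\beta\}$; it is regular if $\alpha\sim\alpha'$ implies $f(\alpha,\beta)\sim f(\alpha',\beta)$ for all $\alpha,\alpha',\beta\in Sen(L)$. Each $f$ induces $\overline f:Sen(L_s)\to Sen(L)$: $\overline f(\alpha)=\alpha$ for classical $\alpha$, $\overline f$ commutes with $\neg,\wedge$, and $\overline f(\varphi|\psi)=f(\overline f(\varphi),\overline f(\psi))$. $\langle M,f\rangle\models_s\varphi$ iff $M\models\overline f(\varphi)$. $\varphi\sim_X\psi$ means: for every $M$ and every $f\in X$, $\langle M,f\rangle\models_s\varphi\iff\langle M,f\rangle\models_s\psi$. For $\varphi\in Sen(L_s)$, $Sub(\varphi)$ is the set of subsentences of $\varphi$, and $\varphi[\sigma'/\sigma]$ is the result of replacing $\sigma$ by $\sigma'$ throughout $\varphi$. $\sim_X$ is logically closed if for all $\varphi$, all $\sigma\in Sub(\varphi)$ and all $\sigma'$: $\sigma\sim_X\sigma'$ implies $\varphi\sim_X\varphi[\sigma'/\sigma]$. *)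

theory Defs
  imports Main
begin

datatype sen = Atom nat | Neg sen | Conj sen sen

datatype sen_s =
    SAtom nat
  | SNeg sen_s
  | SConj sen_s sen_s
  | Super sen_s sen_s  (* the primitive connective written | *)

(* The inclusion of L in L_s. *)
primrec emb :: "sen \<Rightarrow> sen_s" where
  "emb (Atom n) = SAtom n"
| "emb (Neg \<alpha>) = SNeg (emb \<alpha>)"
| "emb (Conj \<alpha> \<beta>) = SConj (emb \<alpha>) (emb \<beta>)"

(* M is a map on all L-sentences; M \<alpha> says that M satisfies \<alpha>. *)
definition truth_assignment :: "(sen \<Rightarrow> bool) \<Rightarrow> bool" where
  "truth_assignment M \<longleftrightarrow>
     (\<forall>\<alpha>. M (Neg \<alpha>) \<longleftrightarrow> \<not> M \<alpha>) \<and>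
     (\<forall>\<alpha> \<beta>. M (Conj \<alpha> \<beta>) \<longleftrightarrow> M \<alpha> \<and> M \<beta>)"

definition cl_equiv :: "sen \<Rightarrow> sen \<Rightarrow> bool"  (infix "\<sim>" 50) where
  "\<alpha> \<sim> \<beta> \<longleftrightarrow> (\<forall>M. truth_assignment M \<longrightarrow> (M \<alpha> \<longleftrightarrow> M \<beta>))"

(* f(\<alpha>,\<beta>) is the value of f at the unordered pair {\<alpha>,\<beta>}, so it is written f {\<alpha>, \<beta>} and is
   symmetric in \<alpha> and \<beta>. Values of f at sets not of the form {\<alpha>, \<beta>} are unconstrained
   and never used. *)
definition choice_function :: "(sen set \<Rightarrow> sen) \<Rightarrow> bool" where
  "choice_function f \<longleftrightarrow> (\<forall>\<alpha> \<beta>. f {\<alpha>, \<beta>} \<in> {\<alpha>, \<beta>})"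

definition regular :: "(sen set \<Rightarrow> sen) \<Rightarrow> bool" where
  "regular f \<longleftrightarrow> (\<forall>\<alpha> \<alpha>' \<beta>. \<alpha> \<sim> \<alpha>' \<longrightarrow> f {\<alpha>, \<beta>} \<sim> f {\<alpha>', \<beta>})"

primrec fbar :: "(sen set \<Rightarrow> sen) \<Rightarrow> sen_s \<Rightarrow> sen" where
  "fbar f (SAtom n) = Atom n"
| "fbar f (SNeg \<phi>) = Neg (fbar f \<phi>)"
| "fbar f (SConj \<phi> \<psi>) = Conj (fbar f \<phi>) (fbar f \<psi>)"
| "fbar f (Super \<phi> \<psi>) = f {fbar f \<phi>, fbar f \<psi>}"

lemma fbar_emb: "fbar f (emb \<alpha>) = \<alpha>"
  by (induction \<alpha>) simp_all

definition sat_s :: "(sen \<Rightarrow> bool) \<Rightarrow> (sen set \<Rightarrow> sen) \<Rightarrow> sen_s \<Rightarrow> bool" where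
  "sat_s M f \<phi> \<longleftrightarrow> M (fbar f \<phi>)"

definition equiv_on :: "(sen set \<Rightarrow> sen) set \<Rightarrow> sen_s \<Rightarrow> sen_s \<Rightarrow> bool" where
  "equiv_on X \<phi> \<psi> \<longleftrightarrow>
     (\<forall>M. truth_assignment M \<longrightarrow> (\<forall>f\<in>X. sat_s M f \<phi> \<longleftrightarrow> sat_s M f \<psi>))"

primrec Sub :: "sen_s \<Rightarrow> sen_s set" where
  "Sub (SAtom n) = {SAtom n}"
| "Sub (SNeg \<phi>) = insert (SNeg \<phi>) (Sub \<phi>)"
| "Sub (SConj \<phi> \<psi>) = insert (SConj \<phi> \<psi>) (Sub \<phi> \<union> Sub \<psi>)"
| "Sub (Super \<phi> \<psi>) = insert (Super \<phi> \<psi>) (Sub \<phi> \<union> Sub \<psi>)"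

(* replace \<sigma> \<sigma>' \<phi> is \<phi>[\<sigma>'/\<sigma>]: every occurrence of \<sigma> in \<phi> becomes \<sigma>', simultaneously;
   the inserted copies of \<sigma>' are not searched again. *)
primrec replace :: "sen_s \<Rightarrow> sen_s \<Rightarrow> sen_s \<Rightarrow> sen_s" where
  "replace \<sigma> \<sigma>' (SAtom n) = (if SAtom n = \<sigma> then \<sigma>' else SAtom n)"
| "replace \<sigma> \<sigma>' (SNeg \<phi>) =
     (if SNeg \<phi> = \<sigma> then \<sigma>' else SNeg (replace \<sigma> \<sigma>' \<phi>))"
| "replace \<sigma> \<sigma>' (SConj \<phi> \<psi>) =
     (if SConj \<phi> \<psi> = \<sigma> then \<sigma>' else SConj (replace \<sigma> \<sigma>' \<phi>) (replace \<sigma> \<sigma>' \<psi>))"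
| "replace \<sigma> \<sigma>' (Super \<phi> \<psi>) =
     (if Super \<phi> \<psi> = \<sigma> then \<sigma>' else Super (replace \<sigma> \<sigma>' \<phi>) (replace \<sigma> \<sigma>' \<psi>))"

definition logically_closed :: "(sen_s \<Rightarrow> sen_s \<Rightarrow> bool) \<Rightarrow> bool" where
  "logically_closed R \<longleftrightarrow>
     (\<forall>\<phi>. \<forall>\<sigma>\<in>Sub \<phi>. \<forall>\<sigma>'. R \<sigma> \<sigma>' \<longrightarrow> R \<phi> (replace \<sigma> \<sigma>' \<phi>))"

end

(* If all f in X are regular, replacing a subsentence by an equivalent one preserves equivalence, by
   induction on the sentence. Conversely, let \<alpha> \<sim> \<alpha>'. Substituting \<alpha>' for \<alpha> directly in \<alpha>|\<beta> might
   also change \<beta>. So take a sentence \<gamma> \<sim> \<alpha> too large to occur in \<beta> and substitute \<alpha> and \<alpha>' for \<gamma>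
   in \<gamma>|\<beta>: logical closure makes both f(\<alpha>,\<beta>) and f(\<alpha>',\<beta>) equivalent to f(\<gamma>,\<beta>). *)
theory Submission
  imports Defs
begin

lemma cl_equiv_refl: "\<alpha> \<sim> \<alpha>"
  by (simp add: cl_equiv_def)

lemma cl_equiv_sym: "\<alpha> \<sim> \<beta> \<Longrightarrow> \<beta> \<sim> \<alpha>"
  unfolding cl_equiv_def by metis

lemma cl_equiv_trans: "\<alpha> \<sim> \<beta> \<Longrightarrow> \<beta> \<sim> \<gamma> \<Longrightarrow> \<alpha> \<sim> \<gamma>"
  unfolding cl_equiv_def by metis

lemma cl_equiv_Neg: "\<alpha> \<sim> \<alpha>' \<Longrightarrow> Neg \<alpha> \<sim> Neg \<alpha>'"
  by (simp add: cl_equiv_def truth_assignment_def)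

lemma cl_equiv_Conj: "\<alpha> \<sim> \<alpha>' \<Longrightarrow> \<beta> \<sim> \<beta>' \<Longrightarrow> Conj \<alpha> \<beta> \<sim> Conj \<alpha>' \<beta>'"
proof -
  assume "\<alpha> \<sim> \<alpha>'" "\<beta> \<sim> \<beta>'"
  then have "M (Conj \<alpha> \<beta>) \<longleftrightarrow> M (Conj \<alpha>' \<beta>')" if "truth_assignment M" for M
    using that by (metis cl_equiv_def truth_assignment_def)
  then show ?thesis
    unfolding cl_equiv_def by blast
qed

text \<open>The quantifiers over valuations and over \<open>X\<close> commute, so each f can be
  treated separately as a question of classical equivalence.\<close>

lemma equiv_on_iff_cl_equiv: "equiv_on X \<phi> \<psi> \<longleftrightarrow> (\<forall>f\<in>X. fbar f \<phi> \<sim> fbar f \<psi>)"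
  by (auto simp: equiv_on_def sat_s_def cl_equiv_def)

text \<open>Regularity changes one member of the pair. As pairs are unordered, it also applies to
  the other member, and the two changes compose.\<close>

lemma regular_cong:
  assumes "regular f" "\<alpha> \<sim> \<alpha>'" "\<beta> \<sim> \<beta>'"
  shows "f {\<alpha>, \<beta>} \<sim> f {\<alpha>', \<beta>'}"
proof -
  have "f {\<alpha>, \<beta>} \<sim> f {\<alpha>', \<beta>}"
    using assms(1,2) by (simp add: regular_def)
  moreover have "f {\<beta>, \<alpha>'} \<sim> f {\<beta>', \<alpha>'}"
    using assms(1,3) by (simp add: regular_def)
  ultimately show ?thesis
    by (metis cl_equiv_trans insert_commute)
qed

text \<open>Where the sentence is \<sigma> itself, the hypothesis applies; elsewhere \<sim> is a
  congruence for each connective, by regularity in the case of \<open>Super\<close>.\<close>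

lemma fbar_replace_cl_equiv:
  assumes "regular f" "fbar f \<sigma> \<sim> fbar f \<sigma>'"
  shows "fbar f \<phi> \<sim> fbar f (replace \<sigma> \<sigma>' \<phi>)"
proof (induction \<phi>)
  case (SAtom n)
  then show ?case using assms(2) by (auto simp: cl_equiv_refl)
next
  case (SNeg \<phi>)
  then show ?case using assms(2) by (auto intro: cl_equiv_Neg)
next
  case (SConj \<phi> \<psi>)
  then show ?case using assms(2) by (auto intro: cl_equiv_Conj)
next
  case (Super \<phi> \<psi>)
  then show ?case using assms by (auto intro: regular_cong)
qed

lemma replace_self: "replace \<sigma> \<sigma>' \<sigma> = \<sigma>'"
  by (cases \<sigma>) simp_all

lemma self_in_Sub: "\<phi> \<in> Sub \<phi>"
  by (cases \<phi>) simp_all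

lemma replace_not_Sub: "\<sigma> \<notin> Sub \<phi> \<Longrightarrow> replace \<sigma> \<sigma>' \<phi> = \<phi>"
  by (induction \<phi>) auto

lemma size_Sub: "\<sigma> \<in> Sub \<phi> \<Longrightarrow> size \<sigma> \<le> size \<phi>"
  by (induction \<phi>) auto

lemma ex_cl_equiv_not_Sub: "\<exists>\<gamma>. \<gamma> \<sim> \<alpha> \<and> emb \<gamma> \<notin> Sub (emb \<beta>)"
proof (intro exI conjI)
  \<comment> \<open>The added conjunct is a tautology, so equivalence with \<alpha> is kept; it
    contains \<beta>, so the whole is strictly larger than \<beta> and no subsentence of it.\<close>
  let ?\<gamma> = "Conj \<alpha> (Neg (Conj \<beta> (Neg \<beta>)))"
  show "?\<gamma> \<sim> \<alpha>"
    by (simp add: cl_equiv_def truth_assignment_def)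
  show "emb ?\<gamma> \<notin> Sub (emb \<beta>)"
    by (auto dest: size_Sub)
qed

text \<open>Since \<gamma> does not occur in \<beta>, replacing it by \<alpha> in \<gamma>|\<beta>
  gives exactly \<alpha>|\<beta>.\<close>

lemma logically_closed_fresh:
  assumes "logically_closed (equiv_on X)" "f \<in> X"
    and "\<gamma> \<sim> \<alpha>" "emb \<gamma> \<notin> Sub (emb \<beta>)"
  shows "f {\<gamma>, \<beta>} \<sim> f {\<alpha>, \<beta>}"
proof -
  let ?\<phi> = "Super (emb \<gamma>) (emb \<beta>)"
  have "emb \<gamma> \<in> Sub ?\<phi>"
    by (simp add: self_in_Sub)
  moreover have "equiv_on X (emb \<gamma>) (emb \<alpha>)"
    using assms(3) by (simp add: equiv_on_iff_cl_equiv fbar_emb)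
  ultimately have "equiv_on X ?\<phi> (replace (emb \<gamma>) (emb \<alpha>) ?\<phi>)"
    using assms(1) unfolding logically_closed_def by blast
  \<comment> \<open>A classical sentence is never headed by \<open>Super\<close>, so
    \<open>replace\<close> descends into the two arguments instead of replacing all of
    \<open>?\<phi>\<close>.\<close>
  moreover have "?\<phi> \<noteq> emb \<gamma>"
    by (cases \<gamma>) simp_all
  ultimately show ?thesis
    using assms(2,4)
    by (simp add: equiv_on_iff_cl_equiv fbar_emb replace_self replace_not_Sub)
qed

theorem theorem2p28:
  fixes X :: "(sen set \<Rightarrow> sen) set"
  assumes "X \<noteq> {}"
    and "\<forall>f\<in>X. choice_function f"
  shows "logically_closed (equiv_on X) \<longleftrightarrow> (\<forall>f\<in>X. regular f)"
proof
  assume closed: "logically_closed (equiv_on X)"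
  show "\<forall>f\<in>X. regular f"
    unfolding regular_def
  proof (intro ballI allI impI)
    fix f \<alpha> \<alpha>' \<beta>
    assume "f \<in> X" "\<alpha> \<sim> \<alpha>'"
    obtain \<gamma> where "\<gamma> \<sim> \<alpha>" and fresh: "emb \<gamma> \<notin> Sub (emb \<beta>)"
      using ex_cl_equiv_not_Sub by blast
    then have "\<gamma> \<sim> \<alpha>'"
      using \<open>\<alpha> \<sim> \<alpha>'\<close> cl_equiv_trans by blast
    have "f {\<gamma>, \<beta>} \<sim> f {\<alpha>, \<beta>}" "f {\<gamma>, \<beta>} \<sim> f {\<alpha>', \<beta>}"
      using logically_closed_fresh[OF closed \<open>f \<in> X\<close> _ fresh] \<open>\<gamma> \<sim> \<alpha>\<close> \<open>\<gamma> \<sim> \<alpha>'\<close> by blast+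
    then show "f {\<alpha>, \<beta>} \<sim> f {\<alpha>', \<beta>}"
      using cl_equiv_sym cl_equiv_trans by blast
  qed
next
  assume "\<forall>f\<in>X. regular f"
  then show "logically_closed (equiv_on X)"
    by (simp add: logically_closed_def equiv_on_iff_cl_equiv fbar_replace_cl_equiv)
qed

end
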